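(* Assume that $g_2$ is continuously differentiable with $L_{g_2}$-Lipschitz continuous gradient (while $g_1$ is a proper lower semicontinuous convex function). Let $\{x^n\}_n$ be the bounded sequence generated by Algorithm pABBDCA$_{\mathrm{se}}$ (described in the context) for minimizing $E=f+g_1-g_2$. Suppose $E$ is a KL function with exponent $\theta\in[0,1)$. Then the sequence $\{x^n\}_n$ globally converges to a critical point $x^*$ with a finite trajectory length, i.e. $$\sum_{n=0}^{\infty}\|x^{n+1}-x^n\|<\infty.$$
   Context: Setting. $X$ is a finite-dimensional real Hilbert space with inner product $\langle\cdot,\cdot\rangle$ and norm $\|\cdot\|$. $E(x)=f(x)+g_1(x)-g_2(x)$, where $f$ is convex and continuously differentiable with $L$-Lipschitz gradient, and $g_1,g_2$ are proper closed convex functions. For a convex function, $\partial$ is the convex subdifferential. Standing assumptions: $E$ is bounded from below and all level sets $\{x:E(x)\le\alpha\}$, $\alpha\in\mathbb{R}$, are compact. When $g_2$ is differentiable, $\partial E(x)=\nabla f(x)+\partial g_1(x)-\nabla g_2(x)$; $x$ is a critical point if $0\in\partial E(x)$. $\mathrm{dist}(0,S)=\inf_{s\in S}\|s\|$ ($+\infty$ if $S=\emptyset$). KL exponent. $E$ is a KL function with exponent $\theta\in[0,1)$ if at every critical point $\bar x$ there exist $\bar c,\epsilon>0$ and $\nu\in(0,+\infty]$ such that $\mathrm{dist}(0,\partial E(x))\ge\bar c\,(E(x)-E(\bar x))^{\theta}$ whenever $\|x-\bar x\|\le\epsilon$ and $E(\bar x)<E(x)<E(\bar x)+\nu$ (equivalently,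 the KL inequality $\psi'(E(x)-E(\bar x))\,\mathrm{dist}(0,\partial E(x))\ge1$ holds there with $\psi(s)=cs^{1-\theta}$, $c>0$). Algorithm pABBDCA$_{\mathrm{se}}$. Inputs: $x^0\in X$, $0<\alpha_{\min}<\alpha_{\max}$, $\alpha_0>0$, initial trial step $\lambda_0=1$, $\rho,\overline\beta,\omega\in(0,1)$, $0<\eta<1/\alpha_{\max}$, $c_0>0$; $x^{-1}=x^0$, $\beta_0=0$, $\lambda_{-1}=1$, $\alpha_{-1}=\alpha_0$. For $n=0,1,2,\dots$: 1. Set $\hat\beta_n=\min\{\frac{n-1}{n+2},\overline\beta\}$; if $n\ge1$ set $\beta_n=\max\{0,\min\{\hat\beta_n,\frac{\alpha_n}{\alpha_{n-1}\lambda_{n-1}}(2-\beta_{n-1})-2c_0\alpha_n\}\}$. 2. Set $y^n=x^n+\beta_n(x^n-x^{n-1})$. Choose $\xi^n\in\partial g_2(x^n)$ and set $u^n=\arg\min_x\{\langle-\xi^n,x-y^n\rangle+\frac{1}{2\alpha_n}\|x-y^n\|^2+f(x)+g_1(x)\}$. 3. Set $d^n=u^n-x^n$, $\nu_n=\frac{\omega}{n+1}\|d^n\|^2$. If $d^n=0$, stop. 4. (Line search) Find the smallest integer $k\ge0$ such that the accepted step $\lambda_n=\lambda_0\rho^k$ (here $\lambda_0=1$ is the initial trial step) satisfies $E(x^n+\lambda_nd^n)\le E(x^n)-\eta\lambda_n\|d^n\|^2+\nu_n$. Set $x^{n+1}=x^n+\lambda_nd^n$, $s^n=x^{n+1}-y^n$,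 $y_{bb}^n=\nabla f(x^{n+1})-\nabla f(y^n)$. 5. If $\langle s^n,y_{bb}^n\rangle>0$, set $\alpha_{n+1}=\max\{\alpha_{\min},\min\{\alpha_{\max},\tau_n\}\}$ with $\tau_n=\langle s^n,s^n\rangle/\langle s^n,y_{bb}^n\rangle$ for $n$ even and $\tau_n=\langle s^n,y_{bb}^n\rangle/\langle y_{bb}^n,y_{bb}^n\rangle$ for $n$ odd; otherwise $\alpha_{n+1}=\alpha_{\max}$. The sequences considered are infinite (no stopping rule other than $d^n=0$, and the algorithm does not stop). *)

theory Defs
  imports "HOL-Analysis.Analysis"
begin

section \<open>Extended-valued convex functions\<close>

definition ereal_epigraph :: "('a \<Rightarrow> ereal) \<Rightarrow> ('a \<times> real) set" where
  "ereal_epigraph h = {(x, r). h x \<le> ereal r}"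

text \<open>Closedness of the epigraph is lower semicontinuity.\<close>

definition proper_closed_convex :: "('a::euclidean_space \<Rightarrow> ereal) \<Rightarrow> bool" where
  "proper_closed_convex h \<longleftrightarrow>
     (\<forall>x. h x \<noteq> -\<infinity>) \<and> (\<exists>x. h x \<noteq> \<infinity>) \<and>
     convex (ereal_epigraph h) \<and> closed (ereal_epigraph h)"

definition subdifferential :: "('a::euclidean_space \<Rightarrow> ereal) \<Rightarrow> 'a \<Rightarrow> 'a set" where
  "subdifferential h x =
     {v. \<bar>h x\<bar> \<noteq> \<infinity> \<and> (\<forall>z. h x + ereal (v \<bullet> (z - x)) \<le> h z)}"

text \<open>As infima are taken in the extended reals, this is \<open>\<infinity>\<close> for the empty set
  (unlike \<^const>\<open>infdist\<close>, which is then 0).\<close>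

definition dist_zero :: "'a::real_normed_vector set \<Rightarrow> ereal" where
  "dist_zero S = (INF s\<in>S. ereal (norm s))"

section \<open>The difference-of-convex problem\<close>

text \<open>The subtracted convex function is finite everywhere, as it has to be once it is
  differentiable on the whole space; only \<open>g1\<close> may take the value \<open>\<infinity>\<close>.\<close>

definition energy ::
    "('a \<Rightarrow> real) \<Rightarrow> ('a \<Rightarrow> ereal) \<Rightarrow> ('a \<Rightarrow> real) \<Rightarrow> 'a \<Rightarrow> ereal" where
  "energy f g1 g2 x = ereal (f x) + g1 x - ereal (g2 x)"

locale dc_problem =
  fixes f :: "'a::euclidean_space \<Rightarrow> real"
    and gradf :: "'a \<Rightarrow> 'a"
    and L :: real
    and g1 :: "'a \<Rightarrow> ereal"
    and g2 :: "'a \<Rightarrow> real"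
  assumes f_convex: "convex_on UNIV f"
    and f_gradient: "\<And>x. GDERIV f x :> gradf x"
    and f_gradient_lipschitz: "L-lipschitz_on UNIV gradf"
    and g1_proper_closed_convex: "proper_closed_convex g1"
    and g2_convex: "convex_on UNIV g2"
    and energy_bounded_below: "\<exists>m::real. \<forall>x. ereal m \<le> energy f g1 g2 x"
    and energy_level_compact: "\<And>a::real. compact {x. energy f g1 g2 x \<le> ereal a}"

text \<open>The subdifferential of the energy for differentiable \<open>g2\<close>:
  \<open>\<nabla>f(x) + \<partial>g1(x) - \<nabla>g2(x)\<close>.\<close>

definition energy_subdifferential ::
    "('a \<Rightarrow> 'a) \<Rightarrow> ('a \<Rightarrow> ereal) \<Rightarrow> ('a \<Rightarrow> 'a) \<Rightarrow> 'a::euclidean_space \<Rightarrow> 'a set" where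
  "energy_subdifferential gradf g1 gradg2 x =
     (\<lambda>v. gradf x + v - gradg2 x) ` subdifferential g1 x"

definition critical_point ::
    "('a \<Rightarrow> 'a) \<Rightarrow> ('a \<Rightarrow> ereal) \<Rightarrow> ('a \<Rightarrow> 'a) \<Rightarrow> 'a::euclidean_space \<Rightarrow> bool" where
  "critical_point gradf g1 gradg2 x \<longleftrightarrow> 0 \<in> energy_subdifferential gradf g1 gradg2 x"

text \<open>The Kurdyka--Lojasiewicz property with exponent \<open>\<theta>\<close>, for an energy \<open>E\<close> with
  subdifferential \<open>dE\<close>. Where the inequality is required, both energies are finite: the
  energy of a critical point is, and \<open>E x\<close> lies strictly between two extended reals.\<close>

definition KL_exponent ::
    "('a::euclidean_space \<Rightarrow> ereal) \<Rightarrow> ('a \<Rightarrow> 'a set) \<Rightarrow> real \<Rightarrow> bool" where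
  "KL_exponent E dE \<theta> \<longleftrightarrow> 0 \<le> \<theta> \<and> \<theta> < 1 \<and>
     (\<forall>xbar. 0 \<in> dE xbar \<longrightarrow>
        (\<exists>c>0. \<exists>\<epsilon>>0. \<exists>\<nu>::ereal. 0 < \<nu> \<and>
          (\<forall>x. norm (x - xbar) \<le> \<epsilon> \<and> E xbar < E x \<and> E x < E xbar + \<nu> \<longrightarrow>
             ereal (c * real_of_ereal (E x - E xbar) powr \<theta>) \<le> dist_zero (dE x))))"

section \<open>The algorithm\<close>

definition subproblem_objective ::
    "('a \<Rightarrow> real) \<Rightarrow> ('a \<Rightarrow> ereal) \<Rightarrow> 'a \<Rightarrow> 'a \<Rightarrow> real \<Rightarrow> 'a::euclidean_space \<Rightarrow> ereal" where
  "subproblem_objective f g1 \<xi> y \<alpha> z =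
     ereal ((- \<xi>) \<bullet> (z - y) + 1 / (2 * \<alpha>) * (norm (z - y))\<^sup>2 + f z) + g1 z"

definition sufficient_decrease ::
    "('a::euclidean_space \<Rightarrow> ereal) \<Rightarrow> real \<Rightarrow> real \<Rightarrow> 'a \<Rightarrow> 'a \<Rightarrow> real \<Rightarrow> bool" where
  "sufficient_decrease E \<eta> \<nu> x d t \<longleftrightarrow>
     E (x + t *\<^sub>R d) \<le> E x - ereal (\<eta> * t * (norm d)\<^sup>2) + ereal \<nu>"

definition bb_stepsize ::
    "real \<Rightarrow> real \<Rightarrow> nat \<Rightarrow> 'a::euclidean_space \<Rightarrow> 'a \<Rightarrow> real" where
  "bb_stepsize \<alpha>min \<alpha>max n s v =
     (if s \<bullet> v > 0
      then max \<alpha>min (min \<alpha>max (if even n then (s \<bullet> s) / (s \<bullet> v) else (s \<bullet> v) / (v \<bullet> v)))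
      else \<alpha>max)"

text \<open>An infinite run of the algorithm. \<open>lam n\<close> is the step accepted in iteration \<open>n\<close>; the
  backtracking starts from the trial step 1. For \<open>n = 0\<close> the truncated subtraction
  turns \<open>x (n - 1)\<close> into \<open>x 0\<close>, which is the convention \<open>x\<^sup>-\<^sup>1 = x\<^sup>0\<close>.\<close>

locale pABBDCA_se =
  fixes f :: "'a::euclidean_space \<Rightarrow> real"
    and gradf :: "'a \<Rightarrow> 'a"
    and g1 :: "'a \<Rightarrow> ereal"
    and g2 :: "'a \<Rightarrow> real"
    and \<alpha>min \<alpha>max \<rho> \<beta>bar \<omega> \<eta> c0 :: real
    and x y \<xi> u d :: "nat \<Rightarrow> 'a"
    and \<alpha> \<beta> lam :: "nat \<Rightarrow> real"
  assumes \<alpha>_bounds: "0 < \<alpha>min" "\<alpha>min < \<alpha>max"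
    and \<alpha>_init: "0 < \<alpha> 0"
    and \<rho>_range: "0 < \<rho>" "\<rho> < 1"
    and \<beta>bar_range: "0 < \<beta>bar" "\<beta>bar < 1"
    and \<omega>_range: "0 < \<omega>" "\<omega> < 1"
    and \<eta>_range: "0 < \<eta>" "\<eta> < 1 / \<alpha>max"
    and c0_pos: "0 < c0"
    and \<beta>_init: "\<beta> 0 = 0"
    and \<beta>_step: "\<And>n. n \<ge> 1 \<Longrightarrow>
      \<beta> n = max 0 (min (min ((real n - 1) / (real n + 2)) \<beta>bar)
        (\<alpha> n / (\<alpha> (n - 1) * lam (n - 1)) * (2 - \<beta> (n - 1)) - 2 * c0 * \<alpha> n))"
    and y_step: "\<And>n. y n = x n + \<beta> n *\<^sub>R (x n - x (n - 1))"
    and \<xi>_choice: "\<And>n. \<xi> n \<in> subdifferential (\<lambda>z. ereal (g2 z)) (x n)"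
    and u_argmin:
      "\<And>n. is_arg_min (subproblem_objective f g1 (\<xi> n) (y n) (\<alpha> n)) (\<lambda>z. z \<in> UNIV) (u n)"
    and d_step: "\<And>n. d n = u n - x n"
    and no_stop: "\<And>n. d n \<noteq> 0"
    and line_search: "\<And>n. \<exists>k.
      sufficient_decrease (energy f g1 g2) \<eta> (\<omega> / (real n + 1) * (norm (d n))\<^sup>2)
        (x n) (d n) (\<rho> ^ k) \<and>
      (\<forall>j<k. \<not> sufficient_decrease (energy f g1 g2) \<eta> (\<omega> / (real n + 1) * (norm (d n))\<^sup>2)
        (x n) (d n) (\<rho> ^ j)) \<and>
      lam n = \<rho> ^ k"
    and x_step: "\<And>n. x (Suc n) = x n + lam n *\<^sub>R d n"
    and \<alpha>_step: "\<And>n. \<alpha> (Suc n) =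
      bb_stepsize \<alpha>min \<alpha>max n (x (Suc n) - y n) (gradf (x (Suc n)) - gradf (y n))"

end

theory Submission
  imports Defs
begin

text \<open>
  Write \<open>\<Delta> n = x n - x (n - 1)\<close>. Comparing the minimizer \<open>u n\<close> of the subproblem with \<open>x n\<close>, and
  using convexity of \<open>f + g1\<close> and of \<open>g2\<close> along the segment between them, gives
  \<open>E (x n + t * d n) \<le> E (x n) - t / \<alpha> n * \<parallel>d n\<parallel>\<^sup>2 + t * \<beta> n / \<alpha> n * (d n \<bullet> \<Delta> n)\<close> for \<open>0 \<le> t \<le> 1\<close>.
  The cap on \<open>\<beta> n\<close> is tuned so that the extrapolation term can be absorbed in a potential: for
  \<open>H n = E (x n) + (2 - \<beta> (n - 1)) / (2 * \<alpha> (n - 1) * lam (n - 1)) * \<parallel>\<Delta> n\<parallel>\<^sup>2\<close> one has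
  \<open>H n - H (n + 1) \<ge> c * \<parallel>\<Delta> n\<parallel>\<^sup>2\<close> (\<open>H_descent\<close>). Hence \<open>H\<close> converges and \<open>\<Delta>\<close> tends to 0, however
  the line search has chosen the steps.

  The accepted steps \<open>lam n\<close> need not be bounded away from 0, so that a small \<open>\<Delta> (n + 1) = lam n * d n\<close>
  does not by itself make \<open>d n\<close> small. Instead, either the full step was taken, or some longer
  trial step was rejected, and a rejection has two consequences. Combined with the estimate
  above it forces \<open>d n\<close> to be dominated by \<open>\<Delta> n\<close> (\<open>norm_d_le\<close>); combined with the Lipschitz continuity of
  the gradient of \<open>g2\<close> it forces \<open>E (x (n + 1))\<close> to exceed \<open>E (u n)\<close> by at most a multiple of \<open>\<parallel>d n\<parallel>\<^sup>2\<close>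
  (\<open>E_x_Suc_le_E_u\<close>). So both the size of a subgradient of the energy at \<open>u n\<close> and the difference
  between \<open>H (n + 1)\<close> and \<open>E (u n)\<close> are controlled by \<open>\<parallel>\<Delta> n\<parallel> + \<parallel>\<Delta> (n + 1)\<parallel>\<close>. Every cluster point of
  the run is critical with energy \<open>lim H\<close> (\<open>cluster_point_critical\<close>), and the KL inequality, applied
  at \<open>u n\<close> rather than at \<open>x n\<close>, becomes
  \<open>(H (n + 1) - lim H) powr \<theta>' \<le> C * (\<parallel>\<Delta> n\<parallel> + \<parallel>\<Delta> (n + 1)\<parallel>)\<close> with \<open>\<theta>' = max \<theta> (1/2)\<close>. A
  compactness argument makes \<open>C\<close> uniform for all large \<open>n\<close> (\<open>KL_bound_along_run\<close>), which avoids
  having to trap the run in a single ball. Descent and this bound together give finite length by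
  concavity of \<open>s powr (1 - \<theta>')\<close> (\<open>summable_steps_if_powr_descent\<close>).
\<close>

section \<open>Convex analysis\<close>

lemma GDERIV_directional:
  assumes "GDERIV h p :> v"
  shows "((\<lambda>t. (h (p + t *\<^sub>R e) - h p) / t) \<longlongrightarrow> v \<bullet> e) (at_right 0)"
proof -
  have "(h has_derivative (\<lambda>z. z \<bullet> v)) (at (p + 0 *\<^sub>R e))"
    using assms by (simp add: gderiv_def)
  moreover have "((\<lambda>t. p + t *\<^sub>R e) has_derivative (\<lambda>t. t *\<^sub>R e)) (at 0)"
    by (auto intro!: derivative_eq_intros)
  ultimately have "((\<lambda>t. h (p + t *\<^sub>R e)) has_derivative (\<lambda>t. (t *\<^sub>R e) \<bullet> v)) (at 0)"
    by (rule has_derivative_compose[rotated])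
  then have "((\<lambda>t. h (p + t *\<^sub>R e)) has_field_derivative (v \<bullet> e)) (at 0)"
    by (simp add: has_field_derivative_def inner_commute mult.commute[of _ "e \<bullet> v"])
  then have "((\<lambda>t. (h (p + t *\<^sub>R e) - h p) / t) \<longlongrightarrow> v \<bullet> e) (at 0)"
    by (simp add: DERIV_def)
  then show ?thesis by (rule tendsto_mono[OF at_le, rotated]) simp
qed

lemma inner_le_gradient_if_below_difference_quotient:
  assumes "GDERIV h p :> v" "\<And>t. 0 < t \<Longrightarrow> t < 1 \<Longrightarrow> t * b \<le> h (p + t *\<^sub>R e) - h p"
  shows "b \<le> v \<bullet> e"
proof (rule tendsto_lowerbound[OF GDERIV_directional[OF assms(1)]])
  have "\<forall>\<^sub>F t in at_right 0. t \<in> {0<..<1::real}"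
    by (rule eventually_at_right_real) simp
  then show "\<forall>\<^sub>F t in at_right 0. b \<le> (h (p + t *\<^sub>R e) - h p) / t"
    by eventually_elim (use assms(2) in \<open>auto simp: pos_le_divide_eq mult.commute\<close>)
qed simp

lemma convex_gradient_inequality:
  assumes "convex_on UNIV h" "GDERIV h p :> v"
  shows "h p + v \<bullet> (z - p) \<le> h z"
proof -
  have "- (h z - h p) \<le> (- v) \<bullet> (z - p)"
  proof (rule inner_le_gradient_if_below_difference_quotient[where h = "\<lambda>z. - h z" and p = p])
    show "GDERIV (\<lambda>z. - h z) p :> - v"
      using assms(2) by (rule GDERIV_minus)
    fix t :: real assume t: "0 < t" "t < 1"
    have "h ((1 - t) *\<^sub>R p + t *\<^sub>R z) \<le> (1 - t) * h p + t * h z"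
      using t by (intro convex_onD[OF assms(1)]) auto
    moreover have "(1 - t) *\<^sub>R p + t *\<^sub>R z = p + t *\<^sub>R (z - p)" by (simp add: algebra_simps)
    ultimately show "t * - (h z - h p) \<le> - h (p + t *\<^sub>R (z - p)) - - h p"
      by (simp add: algebra_simps)
  qed
  then show ?thesis by simp
qed

text \<open>A subgradient \<open>\<zeta>\<close> is below every directional derivative; in the direction \<open>\<zeta> - v\<close> this leaves
  no room between \<open>\<zeta>\<close> and \<open>v\<close>.\<close>

lemma subgradient_eq_gradient:
  assumes "\<zeta> \<in> subdifferential (\<lambda>z. ereal (h z)) p" "GDERIV h p :> v"
  shows "\<zeta> = v"
proof -
  have sub: "h p + \<zeta> \<bullet> (z - p) \<le> h z" for z
    using assms(1) by (simp add: subdifferential_def)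
  have "\<zeta> \<bullet> (\<zeta> - v) \<le> v \<bullet> (\<zeta> - v)"
  proof (rule inner_le_gradient_if_below_difference_quotient[OF assms(2)])
    fix t :: real
    show "t * (\<zeta> \<bullet> (\<zeta> - v)) \<le> h (p + t *\<^sub>R (\<zeta> - v)) - h p"
      using sub[of "p + t *\<^sub>R (\<zeta> - v)"] by simp
  qed
  then have "(\<zeta> - v) \<bullet> (\<zeta> - v) \<le> 0" by (simp only: inner_diff_left)
  then show ?thesis by (metis inner_gt_zero_iff leD right_minus_eq)
qed

lemma proper_closed_convex_segment:
  assumes g: "proper_closed_convex g" and fin: "g p \<noteq> \<infinity>" "g q \<noteq> \<infinity>" and t: "0 \<le> t" "t \<le> 1"
  shows "g (p + t *\<^sub>R (q - p)) \<le>
    ereal ((1 - t) * real_of_ereal (g p) + t * real_of_ereal (g q))"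
proof -
  have "\<bar>g p\<bar> \<noteq> \<infinity>" "\<bar>g q\<bar> \<noteq> \<infinity>" using g fin by (auto simp: proper_closed_convex_def)
  then have "(p, real_of_ereal (g p)) \<in> ereal_epigraph g" "(q, real_of_ereal (g q)) \<in> ereal_epigraph g"
    by (auto simp: ereal_epigraph_def ereal_real)
  then have "(1 - t) *\<^sub>R (p, real_of_ereal (g p)) + t *\<^sub>R (q, real_of_ereal (g q)) \<in> ereal_epigraph g"
    using g t by (intro convexD) (auto simp: proper_closed_convex_def)
  moreover have "(1 - t) *\<^sub>R p + t *\<^sub>R q = p + t *\<^sub>R (q - p)" by (simp add: algebra_simps)
  ultimately show ?thesis by (simp add: ereal_epigraph_def)
qed

text \<open>Fermat's rule for a smooth plus a convex function. Moving from \<open>p\<close> towards \<open>z\<close> by a small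
  fraction \<open>t\<close> raises \<open>g\<close> by at most \<open>t * (g z - g p)\<close>, and minimality says that \<open>\<phi>\<close> cannot fall by
  more; dividing by \<open>t\<close> and letting it tend to 0 yields the subgradient inequality.\<close>

lemma neg_gradient_subgradient_at_minimizer:
  assumes g: "proper_closed_convex g" and \<phi>: "GDERIV \<phi> p :> w"
    and min: "\<And>z. ereal (\<phi> p) + g p \<le> ereal (\<phi> z) + g z"
  shows "- w \<in> subdifferential g p"
proof -
  obtain z0 where "g z0 \<noteq> \<infinity>" using g by (auto simp: proper_closed_convex_def)
  then have pinf: "g p \<noteq> \<infinity>" using min[of z0] by auto
  have ninf: "g z \<noteq> -\<infinity>" for z using g by (auto simp: proper_closed_convex_def)
  have "g p + ereal ((- w) \<bullet> (z - p)) \<le> g z" for z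
  proof (cases "g z = \<infinity>")
    case False
    obtain a b where ab: "g p = ereal a" "g z = ereal b"
      using False pinf ninf by (metis ereal_cases)
    have "a - b \<le> w \<bullet> (z - p)"
    proof (rule inner_le_gradient_if_below_difference_quotient[OF \<phi>])
      fix t :: real assume t: "0 < t" "t < 1"
      have "ereal (\<phi> p) + g p \<le> ereal (\<phi> (p + t *\<^sub>R (z - p))) + g (p + t *\<^sub>R (z - p))"
        by (rule min)
      also have "\<dots> \<le> ereal (\<phi> (p + t *\<^sub>R (z - p))) + ereal ((1 - t) * a + t * b)"
        using proper_closed_convex_segment[OF g pinf False, of t] t ab by (intro add_left_mono) auto
      finally show "t * (a - b) \<le> \<phi> (p + t *\<^sub>R (z - p)) - \<phi> p"
        using ab by (simp add: algebra_simps)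
    qed
    then show ?thesis by (simp add: ab)
  qed simp
  then show ?thesis using pinf ninf by (auto simp: subdifferential_def)
qed

section \<open>Sequences with a power-type descent inequality\<close>

lemma summable_if_le_decrement:
  fixes a b :: "nat \<Rightarrow> real"
  assumes "\<And>n. 0 \<le> a n" "\<And>n. 0 \<le> b n" "\<And>n. a n \<le> b n - b (Suc n)"
  shows "summable a"
proof (rule summableI_nonneg_bounded[where x = "b 0"])
  fix n
  have "sum a {..<n} \<le> b 0 - b n"
  proof (induction n)
    case (Suc n)
    then show ?case using assms(3)[of n] by simp
  qed simp
  then show "sum a {..<n} \<le> b 0" using assms(2)[of n] by simp
qed (use assms in auto)

text \<open>The tangent inequality for the concave function \<open>s powr (1 - \<theta>)\<close>, multiplied by
  \<open>s powr \<theta>\<close> so that it also makes sense at 0. In this form it is weighted AM-GM for \<open>s\<close> and \<open>t\<close>.\<close>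

lemma powr_decrement_lower_bound:
  fixes s t \<theta> :: real
  assumes "0 \<le> t" "t \<le> s" "0 < \<theta>" "\<theta> < 1"
  shows "(1 - \<theta>) * (s - t) \<le> s powr \<theta> * (s powr (1 - \<theta>) - t powr (1 - \<theta>))"
proof (cases "t = 0")
  case True
  have "s powr \<theta> * s powr (1 - \<theta>) = s"
    using assms by (simp flip: powr_add)
  then show ?thesis using True assms by (simp add: algebra_simps)
next
  case False
  have "t powr (1 - \<theta>) * s powr \<theta> \<le> (1 - \<theta>) * t + \<theta> * s"
    using assms False by (intro Youngs_inequality_0) auto
  moreover have "s powr \<theta> * s powr (1 - \<theta>) = s"
    using assms by (simp flip: powr_add)
  ultimately show ?thesis by (simp add: algebra_simps)
qed

text \<open>With \<open>\<phi> n = h n powr (1 - \<theta>)\<close>, concavity turns the two hypotheses into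
  \<open>(a (n + 1))\<^sup>2 \<le> M * (a n + a (n + 1)) * (\<phi> (n + 1) - \<phi> (n + 2))\<close>. AM-GM splits the product with
  a weight small enough that \<open>a (n + 1)\<close> on the right can be absorbed on the left and \<open>a n\<close>
  telescopes; what remains is a telescoping sum of decrements of \<open>\<phi>\<close>.\<close>

lemma summable_steps_if_powr_descent:
  fixes a h :: "nat \<Rightarrow> real"
  assumes a: "\<And>n. 0 \<le> a n" and h: "\<And>n. 0 \<le> h n" and c: "0 < c" and \<theta>: "0 < \<theta>" "\<theta> < 1"
    and descent: "\<And>n. c * (a n)\<^sup>2 \<le> h n - h (Suc n)"
    and bound: "\<And>n. h (Suc n) powr \<theta> \<le> C * (a n + a (Suc n))"
  shows "summable a"
proof -
  define \<phi> where "\<phi> n = h n powr (1 - \<theta>)" for n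
  define M where "M = max C 0 / (c * (1 - \<theta>))"
  have M: "0 \<le> M" using c \<theta> by (simp add: M_def)
  have mono: "h (Suc n) \<le> h n" for n
    using descent[of n] c by (smt (verit) mult_nonneg_nonneg zero_le_power2)
  have \<phi>_mono: "\<phi> (Suc n) \<le> \<phi> n" for n
    unfolding \<phi>_def using mono h \<theta> by (intro powr_mono2) auto
  have step: "2 * a (Suc n) \<le> (a n + 4 * M * \<phi> (Suc n)) - (a (Suc n) + 4 * M * \<phi> (Suc (Suc n)))" for n
  proof -
    let ?p = "a n + a (Suc n)" and ?\<delta> = "\<phi> (Suc n) - \<phi> (Suc (Suc n))"
    have "(1 - \<theta>) * (c * (a (Suc n))\<^sup>2) \<le> (1 - \<theta>) * (h (Suc n) - h (Suc (Suc n)))"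
      using descent[of "Suc n"] \<theta> by (intro mult_left_mono) auto
    also have "\<dots> \<le> h (Suc n) powr \<theta> * ?\<delta>"
      unfolding \<phi>_def using mono h \<theta> by (intro powr_decrement_lower_bound) auto
    also have "\<dots> \<le> (max C 0 * ?p) * ?\<delta>"
    proof (rule mult_right_mono)
      have "C * ?p \<le> max C 0 * ?p" using a by (intro mult_right_mono) (auto simp: add_nonneg_nonneg)
      then show "h (Suc n) powr \<theta> \<le> max C 0 * ?p" using bound[of n] by linarith
    qed (use \<phi>_mono in simp)
    finally have "(a (Suc n))\<^sup>2 \<le> ?p * (M * ?\<delta>)"
      using c \<theta> by (simp add: M_def field_simps)
    \<comment> \<open>AM-GM: the weight 1/4 leaves \<open>2 * a (Suc n)\<close> after absorbing and telescoping.\<close>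
    also have "\<dots> \<le> (?p / 4 + M * ?\<delta>)\<^sup>2"
      using zero_le_power2[of "?p / 4 - M * ?\<delta>"] by (simp add: power2_eq_square algebra_simps)
    finally have "a (Suc n) \<le> ?p / 4 + M * ?\<delta>"
      by (rule power2_le_imp_le) (use a M \<phi>_mono in \<open>auto intro!: add_nonneg_nonneg mult_nonneg_nonneg\<close>)
    then have "4 * a (Suc n) \<le> ?p + 4 * (M * ?\<delta>)" by argo
    then show ?thesis by (simp add: algebra_simps)
  qed
  have "summable (\<lambda>n. 2 * a (Suc n))"
    by (rule summable_if_le_decrement[where b = "\<lambda>n. a n + 4 * M * \<phi> (Suc n)"])
      (use a M step in \<open>auto simp: \<phi>_def\<close>)
  then have "summable (\<lambda>n. a (Suc n))" by (simp add: summable_cmult_iff)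
  then show ?thesis by (simp only: summable_Suc_iff)
qed

lemma powr_add_le:
  fixes s p q \<theta> :: real
  assumes "0 \<le> s" "s \<le> p + q" "0 \<le> p" "0 \<le> q" "0 \<le> \<theta>" "\<theta> \<le> 1"
  shows "s powr \<theta> \<le> 2 * (p powr \<theta> + q powr \<theta>)"
proof -
  have "s powr \<theta> \<le> (2 * max p q) powr \<theta>"
    using assms by (intro powr_mono2) auto
  also have "\<dots> = 2 powr \<theta> * max p q powr \<theta>"
    by (rule powr_mult)
  also have "\<dots> \<le> 2 powr 1 * (p powr \<theta> + q powr \<theta>)"
    using assms by (intro mult_mono powr_mono) (auto simp: max_def)
  finally show ?thesis by simp
qed


section \<open>Runs of the algorithm with a smooth subtracted term\<close>

locale smooth_pABBDCA_se =
  dc_problem f gradf L g1 g2 +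
  pABBDCA_se f gradf g1 g2 \<alpha>min \<alpha>max \<rho> \<beta>bar \<omega> \<eta> c0 x y \<xi> u d \<alpha> \<beta> lam
  for f :: "'a::euclidean_space \<Rightarrow> real" and gradf L g1 g2
    and \<alpha>min \<alpha>max \<rho> \<beta>bar \<omega> \<eta> c0 :: real and x y \<xi> u d \<alpha> \<beta> lam +
  fixes gradg2 :: "'a \<Rightarrow> 'a" and Lg2 :: real
  assumes g2_gradient: "\<And>z. GDERIV g2 z :> gradg2 z"
    and g2_gradient_lipschitz: "Lg2-lipschitz_on UNIV gradg2"
    and bounded_run: "bounded (range x)"
begin

text \<open>The energy as a real function. It agrees with \<^const>\<open>energy\<close> only where \<open>g1\<close> is finite;
  elsewhere the value is meaningless, since \<open>real_of_ereal \<infinity> = 0\<close>.\<close>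

definition E :: "'a \<Rightarrow> real" where
  "E z = f z + real_of_ereal (g1 z) - g2 z"

definition len :: "nat \<Rightarrow> real" where
  "len n = norm (x n - x (n - 1))"

text \<open>The subgradient of \<open>g1\<close> at \<open>u n\<close> that the optimality condition of the subproblem provides.\<close>

definition v :: "nat \<Rightarrow> 'a" where
  "v n = \<xi> n - (1 / \<alpha> n) *\<^sub>R (u n - y n) - gradf (u n)"

text \<open>The potential whose decrease replaces that of the energy, which the extrapolation may
  increase. The weight is the expression that the cap on \<open>\<beta> n\<close> is built from.\<close>

definition H :: "nat \<Rightarrow> real" where
  "H n = E (x n) + (2 - \<beta> (n - 1)) / (2 * \<alpha> (n - 1) * lam (n - 1)) * (len n)\<^sup>2"

lemma g1_not_MInf: "g1 z \<noteq> -\<infinity>"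
  using g1_proper_closed_convex by (auto simp: proper_closed_convex_def)

lemma g1_real: "g1 z \<noteq> \<infinity> \<Longrightarrow> g1 z = ereal (real_of_ereal (g1 z))"
  using g1_not_MInf[of z] by (cases "g1 z") auto

lemma energy_eq: "g1 z \<noteq> \<infinity> \<Longrightarrow> energy f g1 g2 z = ereal (E z)"
  using g1_not_MInf[of z] by (cases "g1 z") (auto simp: energy_def E_def)

lemma energy_infinite: "g1 z = \<infinity> \<Longrightarrow> energy f g1 g2 z = \<infinity>"
  by (simp add: energy_def)

lemma len_nonneg: "0 \<le> len n" by (simp add: len_def)

lemma lam_range: "0 < lam n" "lam n \<le> 1"
proof -
  obtain k where "lam n = \<rho> ^ k" using line_search by blast
  then show "0 < lam n" "lam n \<le> 1" using \<rho>_range by (auto simp: power_le_one)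
qed

lemma len_Suc: "len (Suc n) = lam n * norm (d n)"
  using lam_range[of n] by (simp add: len_def x_step)

lemma \<alpha>_range: "1 \<le> n \<Longrightarrow> \<alpha>min \<le> \<alpha> n" "1 \<le> n \<Longrightarrow> \<alpha> n \<le> \<alpha>max"
  using \<alpha>_bounds \<alpha>_step[of "n - 1"] by (auto simp: bb_stepsize_def)

lemma \<alpha>_pos: "0 < \<alpha> n"
  using \<alpha>_range(1)[of n] \<alpha>_init \<alpha>_bounds by (cases n) auto

lemma \<beta>_nonneg: "0 \<le> \<beta> n"
  using \<beta>_init \<beta>_step[of n] by (cases n) auto

lemma \<beta>_le_1: "\<beta> n \<le> 1"
  using \<beta>_init \<beta>_step[of n] \<beta>bar_range by (cases n) auto

lemma Lg2_nonneg: "0 \<le> Lg2"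
  using g2_gradient_lipschitz by (rule lipschitz_on_nonneg)

lemma gradg2_lipschitz: "norm (gradg2 p - gradg2 q) \<le> Lg2 * norm (p - q)"
  using lipschitz_onD[OF g2_gradient_lipschitz, of p q] by (simp add: dist_norm)

lemma \<xi>_eq: "\<xi> n = gradg2 (x n)"
  using \<xi>_choice g2_gradient by (rule subgradient_eq_gradient)

lemma u_minus_y: "u n - y n = d n - \<beta> n *\<^sub>R (x n - x (n - 1))"
  by (simp add: y_step d_step)

lemma subproblem_gradient:
  "GDERIV (\<lambda>z. (- \<zeta>) \<bullet> (z - w) + 1 / (2 * a) * (norm (z - w))\<^sup>2 + f z) p
     :> - \<zeta> + (1 / a) *\<^sub>R (p - w) + gradf p"
proof -
  have "((\<lambda>z. (- \<zeta>) \<bullet> (z - w)) has_derivative (\<lambda>h. (- \<zeta>) \<bullet> h)) (at p)"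
    by (auto intro!: derivative_eq_intros)
  moreover have "((\<lambda>z. (z - w) \<bullet> (z - w)) has_derivative
      (\<lambda>h. (p - w) \<bullet> h + h \<bullet> (p - w))) (at p)"
    by (auto intro!: derivative_eq_intros)
  ultimately have "((\<lambda>z. (- \<zeta>) \<bullet> (z - w) + 1 / (2 * a) * ((z - w) \<bullet> (z - w)) + f z) has_derivative
      (\<lambda>h. (- \<zeta>) \<bullet> h + 1 / (2 * a) * ((p - w) \<bullet> h + h \<bullet> (p - w)) + h \<bullet> gradf p)) (at p)"
    using f_gradient[of p, unfolded gderiv_def]
    by (intro has_derivative_add has_derivative_mult_right)
  moreover have "(\<lambda>h. (- \<zeta>) \<bullet> h + 1 / (2 * a) * ((p - w) \<bullet> h + h \<bullet> (p - w)) + h \<bullet> gradf p)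
      = (\<lambda>h. h \<bullet> (- \<zeta> + (1 / a) *\<^sub>R (p - w) + gradf p))"
  proof
    fix h
    have "1 / (2 * a) * ((p - w) \<bullet> h + h \<bullet> (p - w)) = 1 / a * (h \<bullet> (p - w))"
      by (simp add: inner_commute[of "p - w"])
    then show "(- \<zeta>) \<bullet> h + 1 / (2 * a) * ((p - w) \<bullet> h + h \<bullet> (p - w)) + h \<bullet> gradf p
      = h \<bullet> (- \<zeta> + (1 / a) *\<^sub>R (p - w) + gradf p)"
      by (simp only: inner_right_distrib inner_scaleR_right inner_commute[of "- \<zeta>"])
  qed
  ultimately show ?thesis by (simp only: gderiv_def power2_norm_eq_inner)
qed

lemma v_subgradient: "v n \<in> subdifferential g1 (u n)"
proof -
  have "- (- \<xi> n + (1 / \<alpha> n) *\<^sub>R (u n - y n) + gradf (u n)) \<in> subdifferential g1 (u n)"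
  proof (rule neg_gradient_subgradient_at_minimizer[OF g1_proper_closed_convex subproblem_gradient])
    fix z
    show "ereal (- \<xi> n \<bullet> (u n - y n) + 1 / (2 * \<alpha> n) * (norm (u n - y n))\<^sup>2 + f (u n)) + g1 (u n)
      \<le> ereal (- \<xi> n \<bullet> (z - y n) + 1 / (2 * \<alpha> n) * (norm (z - y n))\<^sup>2 + f z) + g1 z"
      using u_argmin[of n] by (auto simp: is_arg_min_def subproblem_objective_def not_less)
  qed
  then show ?thesis by (simp add: v_def algebra_simps)
qed

lemma g1_u_finite: "g1 (u n) \<noteq> \<infinity>"
  using v_subgradient[of n] by (auto simp: subdifferential_def)

lemma g1_above_tangent:
  assumes "g1 z \<noteq> \<infinity>"
  shows "real_of_ereal (g1 (u n)) + v n \<bullet> (z - u n) \<le> real_of_ereal (g1 z)"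
proof -
  have "g1 (u n) + ereal (v n \<bullet> (z - u n)) \<le> g1 z"
    using v_subgradient by (simp add: subdifferential_def)
  then show ?thesis
    using g1_real[OF assms] g1_real[OF g1_u_finite[of n]] by (metis ereal_less_eq(3) plus_ereal.simps(1))
qed

lemma g1_segment_finite:
  assumes "g1 p \<noteq> \<infinity>" "g1 q \<noteq> \<infinity>" "0 \<le> t" "t \<le> 1"
  shows "g1 (p + t *\<^sub>R (q - p)) \<noteq> \<infinity>"
  using proper_closed_convex_segment[OF g1_proper_closed_convex assms] by auto

text \<open>The starting point may have infinite energy. Then every trial step satisfies the test of the
  line search, the full step is accepted, and \<open>x 1 = u 0\<close> lies in the domain of \<open>g1\<close>. This is why
  all estimates below start at \<open>n = 1\<close>.\<close>

lemma g1_x_finite: "1 \<le> n \<Longrightarrow> g1 (x n) \<noteq> \<infinity>"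
proof (induction n rule: nat_induct_at_least)
  case base
  show ?case
  proof (cases "g1 (x 0) = \<infinity>")
    case True
    obtain k where k: "lam 0 = \<rho> ^ k"
      "\<forall>j<k. \<not> sufficient_decrease (energy f g1 g2) \<eta> (\<omega> / (real 0 + 1) * (norm (d 0))\<^sup>2) (x 0) (d 0) (\<rho> ^ j)"
      using line_search by blast
    have "sufficient_decrease (energy f g1 g2) \<eta> c (x 0) (d 0) t" for c t
      using True by (simp add: sufficient_decrease_def energy_infinite)
    with k have "k = 0" by auto
    then have "x 1 = u 0" using k x_step[of 0] by (simp add: d_step)
    then show ?thesis using g1_u_finite by simp
  next
    case False
    then show ?thesis
      using g1_segment_finite[OF False g1_u_finite, of "lam 0" 0] lam_range[of 0] x_step[of 0]
      by (simp add: d_step)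
  qed
next
  case (Suc n)
  then show ?case
    using g1_segment_finite[OF Suc.IH g1_u_finite, of "lam n" n] lam_range[of n] x_step[of n]
    by (simp add: d_step)
qed

section \<open>The energy along a step\<close>

lemma convex_part_segment_le:
  assumes "1 \<le> n" "0 \<le> t" "t \<le> 1"
  shows "E (x n + t *\<^sub>R d n) + g2 (x n + t *\<^sub>R d n)
    \<le> (1 - t) * (E (x n) + g2 (x n)) + t * (E (u n) + g2 (u n))"
proof -
  have "g1 (x n + t *\<^sub>R d n)
      \<le> ereal ((1 - t) * real_of_ereal (g1 (x n)) + t * real_of_ereal (g1 (u n)))"
    using proper_closed_convex_segment[OF g1_proper_closed_convex g1_x_finite[OF assms(1)] g1_u_finite]
      assms by (simp add: d_step)
  then have "real_of_ereal (g1 (x n + t *\<^sub>R d n))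
      \<le> (1 - t) * real_of_ereal (g1 (x n)) + t * real_of_ereal (g1 (u n))"
    using g1_not_MInf[of "x n + t *\<^sub>R d n"] by (cases "g1 (x n + t *\<^sub>R d n)") auto
  moreover have "f (x n + t *\<^sub>R d n) \<le> (1 - t) * f (x n) + t * f (u n)"
  proof -
    have "x n + t *\<^sub>R d n = (1 - t) *\<^sub>R x n + t *\<^sub>R u n" by (simp add: d_step algebra_simps)
    then show ?thesis using convex_onD[OF f_convex, of t "x n" "u n"] assms by simp
  qed
  ultimately show ?thesis by (simp add: E_def algebra_simps)
qed

lemma g2_tangent: "g2 p + gradg2 p \<bullet> (z - p) \<le> g2 z"
  using g2_convex g2_gradient by (rule convex_gradient_inequality)

text \<open>The subgradient inequalities for \<open>g1\<close> and \<open>f\<close> at \<open>u n\<close>, evaluated at \<open>x n\<close>, bound the change of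
  \<open>f + g1\<close> over the whole step by the slope \<open>v n + gradf (u n)\<close>. Up to the proximal term this slope
  is the gradient of \<open>g2\<close> at \<open>x n\<close>, which the tangent of \<open>g2\<close> cancels.\<close>

lemma E_segment_le_extrapolated:
  assumes n: "1 \<le> n" and t: "0 \<le> t" "t \<le> 1"
  shows "E (x n + t *\<^sub>R d n) \<le> E (x n) - t / \<alpha> n * (norm (d n))\<^sup>2
    + t * \<beta> n / \<alpha> n * (d n \<bullet> (x n - x (n - 1)))"
proof -
  have "real_of_ereal (g1 (u n)) - v n \<bullet> d n \<le> real_of_ereal (g1 (x n))"
    using g1_above_tangent[OF g1_x_finite[OF n], of n]
    by (simp add: d_step inner_diff_right)
  moreover have "f (u n) - gradf (u n) \<bullet> d n \<le> f (x n)"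
    using convex_gradient_inequality[OF f_convex f_gradient, of "u n" "x n"]
    by (simp add: d_step inner_diff_right)
  ultimately have below: "E (u n) + g2 (u n) - (v n + gradf (u n)) \<bullet> d n \<le> E (x n) + g2 (x n)"
    by (simp add: E_def inner_left_distrib)
  have slope: "(v n + gradf (u n)) \<bullet> d n = gradg2 (x n) \<bullet> d n - 1 / \<alpha> n * (norm (d n))\<^sup>2
      + \<beta> n / \<alpha> n * (d n \<bullet> (x n - x (n - 1)))"
  proof -
    have "v n + gradf (u n)
        = gradg2 (x n) - (1 / \<alpha> n) *\<^sub>R (d n - \<beta> n *\<^sub>R (x n - x (n - 1)))"
      by (simp only: v_def \<xi>_eq u_minus_y diff_add_cancel)
    also have "\<dots> \<bullet> d n = gradg2 (x n) \<bullet> d n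
        - 1 / \<alpha> n * (d n \<bullet> d n - \<beta> n * ((x n - x (n - 1)) \<bullet> d n))"
      by (simp only: inner_diff_left[of "gradg2 (x n)"] inner_diff_left[of "d n"] inner_scaleR_left)
    finally show ?thesis
      by (simp only: power2_norm_eq_inner inner_commute[of "d n" "x n - x (n - 1)"]
          right_diff_distrib diff_diff_eq2 add_diff_eq times_divide_eq_left mult_1 mult.assoc
          times_divide_eq_right)
  qed
  have "t * ((E (u n) + g2 (u n)) - (E (x n) + g2 (x n)))
      \<le> t * (gradg2 (x n) \<bullet> d n - 1 / \<alpha> n * (norm (d n))\<^sup>2
        + \<beta> n / \<alpha> n * (d n \<bullet> (x n - x (n - 1))))"
    using below t unfolding slope by (intro mult_left_mono) auto
  moreover have "g2 (x n) + t * (gradg2 (x n) \<bullet> d n) \<le> g2 (x n + t *\<^sub>R d n)"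
    using g2_tangent[of "x n" "x n + t *\<^sub>R d n"] by simp
  ultimately show ?thesis
    using convex_part_segment_le[OF n t] by (simp add: algebra_simps)
qed

text \<open>Along a step the energy is convex up to the curvature of \<open>g2\<close>. The curvature bound
  \<open>g2 (u n) \<le> g2 (x n) + gradg2 (x n) \<bullet> d n + Lg2 * \<parallel>d n\<parallel>\<^sup>2\<close> comes from convexity at \<open>u n\<close>, at the
  cost of the factor 1/2 of the integral form.\<close>

lemma E_segment_le_chord:
  assumes n: "1 \<le> n" and t: "0 \<le> t" "t \<le> 1"
  shows "E (x n + t *\<^sub>R d n) \<le> (1 - t) * E (x n) + t * E (u n) + t * Lg2 * (norm (d n))\<^sup>2"
proof -
  have "g2 (u n) - g2 (x n) \<le> gradg2 (u n) \<bullet> d n"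
    using g2_tangent[of "u n" "x n"] by (simp add: d_step inner_diff_right)
  also have "\<dots> = gradg2 (x n) \<bullet> d n + (gradg2 (u n) - gradg2 (x n)) \<bullet> d n"
    by (simp add: inner_diff_left)
  also have "(gradg2 (u n) - gradg2 (x n)) \<bullet> d n \<le> norm (gradg2 (u n) - gradg2 (x n)) * norm (d n)"
    by (rule norm_cauchy_schwarz)
  also have "\<dots> \<le> (Lg2 * norm (d n)) * norm (d n)"
    using gradg2_lipschitz[of "u n" "x n"] by (intro mult_right_mono) (auto simp: d_step)
  finally have "t * (g2 (u n) - g2 (x n)) \<le> t * (gradg2 (x n) \<bullet> d n + Lg2 * norm (d n) * norm (d n))"
    using t by (intro mult_left_mono) auto
  moreover have "g2 (x n) + t * (gradg2 (x n) \<bullet> d n) \<le> g2 (x n + t *\<^sub>R d n)"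
    using g2_tangent[of "x n" "x n + t *\<^sub>R d n"] by simp
  ultimately show ?thesis
    using convex_part_segment_le[OF n t] by (simp add: algebra_simps power2_eq_square)
qed

text \<open>Backtracking stops at the first success, so the trial before an accepted shorter step has
  failed. A trial that fails the test with its added tolerance fails it without the tolerance too.\<close>

lemma full_step_or_failed_trial:
  assumes n: "1 \<le> n"
  obtains "lam n = 1"
  | t where "0 < t" "t \<le> 1" "E (x n) - \<eta> * t * (norm (d n))\<^sup>2 < E (x n + t *\<^sub>R d n)"
proof -
  let ?\<nu> = "\<omega> / (real n + 1) * (norm (d n))\<^sup>2"
  obtain k where k: "lam n = \<rho> ^ k"
    "\<forall>j<k. \<not> sufficient_decrease (energy f g1 g2) \<eta> ?\<nu> (x n) (d n) (\<rho> ^ j)"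
    using line_search by blast
  show ?thesis
  proof (cases k)
    case 0
    then show ?thesis using k that(1) by simp
  next
    case (Suc j)
    let ?t = "\<rho> ^ j"
    have t: "0 < ?t" "?t \<le> 1" using \<rho>_range by (auto simp: power_le_one)
    have "g1 (x n + ?t *\<^sub>R d n) \<noteq> \<infinity>"
      using g1_segment_finite[OF g1_x_finite[OF n] g1_u_finite, of ?t n] t by (simp add: d_step)
    moreover have "\<not> sufficient_decrease (energy f g1 g2) \<eta> ?\<nu> (x n) (d n) ?t"
      using k Suc by blast
    ultimately have "E (x n) - \<eta> * ?t * (norm (d n))\<^sup>2 + ?\<nu> < E (x n + ?t *\<^sub>R d n)"
      using energy_eq[OF g1_x_finite[OF n]] by (simp add: sufficient_decrease_def energy_eq not_le)
    moreover have "0 \<le> ?\<nu>" using \<omega>_range by simp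
    ultimately show ?thesis using that(2)[OF t] by simp
  qed
qed

lemma extrapolation_inner_le:
  assumes n: "1 \<le> n"
  shows "\<beta> n / \<alpha> n * (d n \<bullet> (x n - x (n - 1))) \<le> 1 / \<alpha>min * (norm (d n) * len n)"
proof -
  have "\<beta> n / \<alpha> n * (d n \<bullet> (x n - x (n - 1))) \<le> \<beta> n / \<alpha> n * (norm (d n) * len n)"
    unfolding len_def using \<beta>_nonneg \<alpha>_pos[of n]
    by (intro mult_left_mono norm_cauchy_schwarz) auto
  also have "\<dots> \<le> 1 / \<alpha>min * (norm (d n) * len n)"
    using \<beta>_nonneg \<beta>_le_1 \<alpha>_range[OF n] \<alpha>_bounds
    by (intro mult_right_mono frac_le) (auto simp: len_nonneg)
  finally show ?thesis .
qed

text \<open>A rejected trial means that the energy did not fall by \<open>\<eta> * t * \<parallel>d n\<parallel>\<^sup>2\<close>, although without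
  extrapolation it would have fallen by at least \<open>t / \<alpha> n * \<parallel>d n\<parallel>\<^sup>2\<close>, which is more because \<open>\<eta> < 1 / \<alpha>max\<close>.
  The extrapolation term must make up the difference, so \<open>d n\<close> is small compared with the
  previous move. If no trial was rejected, \<open>d n\<close> is the next move itself.\<close>

lemma norm_d_le: "\<exists>C\<ge>0. \<forall>n\<ge>1. norm (d n) \<le> C * (len n + len (Suc n))"
proof -
  define \<kappa> where "\<kappa> = 1 / \<alpha>max - \<eta>"
  have \<kappa>: "0 < \<kappa>" using \<eta>_range by (simp add: \<kappa>_def)
  define C where "C = max 1 (1 / (\<alpha>min * \<kappa>))"
  have "norm (d n) \<le> C * (len n + len (Suc n))" if n: "1 \<le> n" for n
    using n
  proof (cases rule: full_step_or_failed_trial)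
    case 1
    then have "norm (d n) \<le> 1 * (len n + len (Suc n))"
      by (simp add: len_Suc len_nonneg)
    also have "\<dots> \<le> C * (len n + len (Suc n))"
      by (intro mult_right_mono) (auto simp: C_def len_nonneg)
    finally show ?thesis .
  next
    case (2 t)
    let ?N = "norm (d n)"
    note inner = extrapolation_inner_le[OF n]
    have scaled: "t * (1 / \<alpha> n * ?N\<^sup>2 - \<eta> * ?N\<^sup>2) < t * (\<beta> n / \<alpha> n * (d n \<bullet> (x n - x (n - 1))))"
      using 2 E_segment_le_extrapolated[OF n, of t] by (simp add: algebra_simps)
    have "1 / \<alpha> n * ?N\<^sup>2 - \<eta> * ?N\<^sup>2 \<le> 1 / \<alpha>min * (?N * len n)"
      using mult_less_cancel_left_pos[OF \<open>0 < t\<close>, THEN iffD1, OF scaled] inner by linarith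
    moreover have "1 / \<alpha>max * ?N\<^sup>2 \<le> 1 / \<alpha> n * ?N\<^sup>2"
      using \<alpha>_range(2)[OF n] \<alpha>_pos[of n] by (intro mult_right_mono) (simp_all add: frac_le)
    ultimately have "\<kappa> * ?N\<^sup>2 \<le> 1 / \<alpha>min * (?N * len n)"
      by (simp add: \<kappa>_def left_diff_distrib)
    then have "?N * (\<kappa> * ?N) \<le> ?N * (1 / \<alpha>min * len n)"
      by (simp add: power2_eq_square mult.left_commute)
    then have "\<kappa> * ?N \<le> 1 / \<alpha>min * len n"
      by (rule mult_left_le_imp_le) (use no_stop[of n] in simp)
    then have "?N \<le> 1 / (\<alpha>min * \<kappa>) * len n"
      using \<kappa> \<alpha>_bounds by (simp add: field_simps)
    also have "\<dots> \<le> C * (len n + len (Suc n))"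
      using \<kappa> \<alpha>_bounds by (intro mult_mono) (auto simp: C_def len_nonneg)
    finally show ?thesis .
  qed
  moreover have "0 \<le> C" by (simp add: C_def)
  ultimately show ?thesis by blast
qed

text \<open>After a rejected trial at \<open>t\<close>, \<open>E\<close> at \<open>x n + t * d n\<close> is almost \<open>E (x n)\<close> or more. As \<open>E\<close> is nearly convex
  on the segment, \<open>E (u n)\<close> cannot lie far below \<open>E (x n)\<close>, and the accepted point in between is
  then not far above \<open>E (u n)\<close>.\<close>

lemma E_x_Suc_le_E_u:
  assumes n: "1 \<le> n"
  shows "E (x (Suc n)) \<le> E (u n) + (2 * Lg2 + \<eta>) * (norm (d n))\<^sup>2"
  using n
proof (cases rule: full_step_or_failed_trial)
  case 1
  then show ?thesis using \<eta>_range Lg2_nonneg by (simp add: x_step d_step)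
next
  case (2 t)
  let ?N = "(norm (d n))\<^sup>2"
  have "t * E (x n) \<le> t * (E (u n) + (Lg2 + \<eta>) * ?N)"
    using 2 E_segment_le_chord[OF n, of t] by (simp add: algebra_simps)
  then have "E (x n) \<le> E (u n) + (Lg2 + \<eta>) * ?N"
    using 2 by simp
  then have "(1 - lam n) * E (x n) \<le> (1 - lam n) * (E (u n) + (Lg2 + \<eta>) * ?N)"
    using lam_range[of n] by (intro mult_left_mono) auto
  moreover have "E (x (Suc n)) \<le> (1 - lam n) * E (x n) + lam n * E (u n) + lam n * Lg2 * ?N"
    unfolding x_step using lam_range[of n] by (intro E_segment_le_chord n) auto
  ultimately have "E (x (Suc n)) \<le> E (u n) + (1 - lam n) * ((Lg2 + \<eta>) * ?N) + lam n * (Lg2 * ?N)"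
    by (simp add: algebra_simps)
  also have "\<dots> \<le> E (u n) + 1 * ((Lg2 + \<eta>) * ?N) + 1 * (Lg2 * ?N)"
    using lam_range[of n] Lg2_nonneg \<eta>_range by (intro add_mono mult_right_mono) auto
  finally show ?thesis by (simp add: algebra_simps)
qed

section \<open>Descent of the potential\<close>

lemma H_Suc: "H (Suc n) = E (x (Suc n)) + (2 - \<beta> n) / (2 * \<alpha> n) * lam n * (norm (d n))\<^sup>2"
  using lam_range[of n] by (simp add: H_def len_Suc power2_eq_square)

lemma H_coeff_nonneg: "0 \<le> (2 - \<beta> n) / (2 * \<alpha> n * lam n)"
  using \<beta>_le_1[of n] \<alpha>_pos[of n] lam_range[of n] by simp

text \<open>Where \<open>\<beta> n > 0\<close> this is the cap on \<open>\<beta> n\<close> divided by \<open>2 * \<alpha> n\<close>. Where \<open>\<beta> n = 0\<close> the cap says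
  nothing, and the gap comes from the weight itself being at least \<open>1 / (2 * \<alpha>max)\<close>; as
  \<open>\<alpha> 0\<close> is not bounded by \<open>\<alpha>max\<close>, this needs \<open>n \<ge> 2\<close>.\<close>

lemma extrapolation_coeff_le:
  assumes n: "2 \<le> n"
  shows "\<beta> n / (2 * \<alpha> n)
    \<le> (2 - \<beta> (n - 1)) / (2 * \<alpha> (n - 1) * lam (n - 1)) - min c0 (1 / (2 * \<alpha>max))"
proof (cases "\<beta> n = 0")
  case True
  have "\<alpha> (n - 1) * lam (n - 1) \<le> \<alpha>max * 1"
    using \<alpha>_range[of "n - 1"] \<alpha>_pos[of "n - 1"] lam_range[of "n - 1"] \<alpha>_bounds n
    by (intro mult_mono) auto
  then have "1 / (2 * \<alpha>max) \<le> (2 - \<beta> (n - 1)) / (2 * (\<alpha> (n - 1) * lam (n - 1)))"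
    using \<beta>_le_1[of "n - 1"] \<alpha>_pos[of "n - 1"] lam_range[of "n - 1"] by (intro frac_le) auto
  then show ?thesis using True by (simp add: mult.assoc)
next
  case False
  define q where "q = (2 - \<beta> (n - 1)) / (2 * \<alpha> (n - 1) * lam (n - 1))"
  have "\<beta> n \<le> \<alpha> n / (\<alpha> (n - 1) * lam (n - 1)) * (2 - \<beta> (n - 1)) - 2 * c0 * \<alpha> n"
  proof -
    have "b \<le> q'" if "b = max 0 (min p q')" "b \<noteq> 0" for b p q' :: real
      using that by linarith
    from this[OF \<beta>_step False] show ?thesis using n by simp
  qed
  also have "\<dots> = 2 * \<alpha> n * (q - c0)"
  proof -
    have "a / X * w - 2 * c0 * a = 2 * a * (w / (2 * X) - c0)" for a X w :: real
      by (simp add: right_diff_distrib)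
    then show ?thesis by (simp only: q_def mult.assoc)
  qed
  finally have "\<beta> n / (2 * \<alpha> n) \<le> q - c0"
    using \<alpha>_pos[of n] by (simp add: divide_le_eq mult.commute)
  then show ?thesis by (simp add: q_def min_def)
qed

text \<open>Splitting \<open>lam n * (d n \<bullet> \<Delta> n)\<close> into squares leaves \<open>\<beta> n / (2 * \<alpha> n) * \<parallel>\<Delta> n\<parallel>\<^sup>2\<close> as the only
  positive term once the part belonging to \<open>H (Suc n)\<close> has been collected.\<close>

lemma H_descent:
  assumes n: "2 \<le> n"
  shows "min c0 (1 / (2 * \<alpha>max)) * (len n)\<^sup>2 \<le> H n - H (Suc n)"
proof -
  have n1: "1 \<le> n" using n by simp
  let ?b = "\<beta> n / (2 * \<alpha> n)" and ?N = "(norm (d n))\<^sup>2"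
  have b: "0 \<le> ?b" using \<beta>_nonneg[of n] \<alpha>_pos[of n] by simp
  have "lam n * (d n \<bullet> (x n - x (n - 1))) \<le> lam n * (norm (d n) * len n)"
    unfolding len_def using lam_range[of n] by (intro mult_left_mono norm_cauchy_schwarz) auto
  moreover have "2 * (lam n * (norm (d n) * len n)) \<le> (lam n * norm (d n))\<^sup>2 + (len n)\<^sup>2"
    using sum_squares_bound[of "lam n * norm (d n)" "len n"] by (simp add: mult.assoc)
  moreover have "(lam n * norm (d n))\<^sup>2 \<le> lam n * ?N"
    using lam_range[of n] power_decreasing[of 1 2 "lam n"]
    by (simp add: power_mult_distrib mult_right_mono)
  ultimately have "2 * (lam n * (d n \<bullet> (x n - x (n - 1)))) \<le> lam n * ?N + (len n)\<^sup>2"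
    by linarith
  then have "?b * (2 * (lam n * (d n \<bullet> (x n - x (n - 1))))) \<le> ?b * (lam n * ?N + (len n)\<^sup>2)"
    using b by (rule mult_left_mono)
  moreover have "E (x (Suc n)) \<le> E (x n) - lam n / \<alpha> n * ?N
      + lam n * \<beta> n / \<alpha> n * (d n \<bullet> (x n - x (n - 1)))"
    unfolding x_step using lam_range[of n] by (intro E_segment_le_extrapolated n1) auto
  moreover have "lam n * \<beta> n / \<alpha> n * (d n \<bullet> (x n - x (n - 1)))
      = ?b * (2 * (lam n * (d n \<bullet> (x n - x (n - 1)))))"
    by simp
  moreover have "(2 - \<beta> n) / (2 * \<alpha> n) * lam n * ?N = lam n / \<alpha> n * ?N - ?b * (lam n * ?N)"
    using \<alpha>_pos[of n] by (simp add: field_simps)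
  ultimately have "H (Suc n) \<le> E (x n) + ?b * (len n)\<^sup>2"
    unfolding H_Suc distrib_left by linarith
  moreover have "?b * (len n)\<^sup>2 \<le> ((2 - \<beta> (n - 1)) / (2 * \<alpha> (n - 1) * lam (n - 1))
      - min c0 (1 / (2 * \<alpha>max))) * (len n)\<^sup>2"
    using extrapolation_coeff_le[OF n] by (rule mult_right_mono) simp
  ultimately show ?thesis
    unfolding H_def[of n] left_diff_distrib by linarith
qed

definition Elim :: real where "Elim = lim H"

lemma descent_rate_pos: "0 < min c0 (1 / (2 * \<alpha>max))"
  using c0_pos \<alpha>_bounds by simp

lemma H_tendsto: "H \<longlonglongrightarrow> Elim" and Elim_le_H: "2 \<le> n \<Longrightarrow> Elim \<le> H n"
proof -
  obtain m where m: "\<And>z. ereal m \<le> energy f g1 g2 z" using energy_bounded_below by blast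
  have "decseq (\<lambda>n. H (n + 2))"
  proof (rule decseq_SucI)
    fix n
    have "0 \<le> min c0 (1 / (2 * \<alpha>max)) * (len (n + 2))\<^sup>2"
      using descent_rate_pos by (intro mult_nonneg_nonneg) auto
    then show "H (Suc n + 2) \<le> H (n + 2)" using H_descent[of "n + 2"] by simp
  qed
  moreover have "m \<le> H (n + 2)" for n
  proof -
    have "m \<le> E (x (n + 2))"
      using m[of "x (n + 2)"] energy_eq[OF g1_x_finite[of "n + 2"]] by simp
    also have "\<dots> \<le> H (n + 2)"
      unfolding H_def using H_coeff_nonneg by (intro le_add_same_cancel1[THEN iffD2] mult_nonneg_nonneg) auto
    finally show ?thesis .
  qed
  ultimately obtain e where e: "(\<lambda>n. H (n + 2)) \<longlonglongrightarrow> e" "\<forall>n. e \<le> H (n + 2)"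
    using decseq_convergent[of "\<lambda>n. H (n + 2)" m] by blast
  have "H \<longlonglongrightarrow> e" by (rule LIMSEQ_offset[OF e(1)])
  moreover from this have "e = Elim" by (simp add: Elim_def limI)
  ultimately show "H \<longlonglongrightarrow> Elim" "2 \<le> n \<Longrightarrow> Elim \<le> H n"
    using e(2)[rule_format, of "n - 2"] by (auto simp del: add_2_eq_Suc')
qed

lemma len_tendsto_0: "len \<longlonglongrightarrow> 0"
proof -
  define c where "c = min c0 (1 / (2 * \<alpha>max))"
  have c: "0 < c" using descent_rate_pos by (simp add: c_def)
  have "(\<lambda>n. (H n - H (Suc n)) / c) \<longlonglongrightarrow> (Elim - Elim) / c"
    using c by (intro tendsto_divide tendsto_diff H_tendsto LIMSEQ_Suc[OF H_tendsto] tendsto_const) auto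
  then have "(\<lambda>n. (H n - H (Suc n)) / c) \<longlonglongrightarrow> 0" by simp
  then have "(\<lambda>n. (len n)\<^sup>2) \<longlonglongrightarrow> 0"
  proof (rule Lim_null_comparison[rotated])
    show "\<forall>\<^sub>F n in sequentially. norm ((len n)\<^sup>2) \<le> (H n - H (Suc n)) / c"
      using eventually_ge_at_top[of 2]
    proof eventually_elim
      case (elim n)
      from H_descent[OF this] have "c * (len n)\<^sup>2 \<le> H n - H (Suc n)" by (simp only: c_def)
      then show ?case using c by (simp add: pos_le_divide_eq mult.commute)
    qed
  qed
  from tendsto_real_sqrt[OF this] show ?thesis by (simp add: len_nonneg)
qed

lemma norm_d_tendsto_0: "(\<lambda>n. norm (d n)) \<longlonglongrightarrow> 0"
proof -
  obtain C where C: "\<And>n. 1 \<le> n \<Longrightarrow> norm (d n) \<le> C * (len n + len (Suc n))"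
    using norm_d_le by blast
  have "(\<lambda>n. C * (len n + len (Suc n))) \<longlonglongrightarrow> C * (0 + 0)"
    by (intro tendsto_intros len_tendsto_0 LIMSEQ_Suc[OF len_tendsto_0])
  then have "(\<lambda>n. C * (len n + len (Suc n))) \<longlonglongrightarrow> 0" by simp
  then show ?thesis
    by (rule Lim_null_comparison[rotated])
      (use C in \<open>auto simp: eventually_at_top_linorder\<close>)
qed

lemma H_Suc_excess:
  assumes "1 \<le> n"
  shows "0 \<le> H (Suc n) - E (x (Suc n))"
    and "H (Suc n) - E (x (Suc n)) \<le> 1 / \<alpha>min * (norm (d n))\<^sup>2"
proof -
  show "0 \<le> H (Suc n) - E (x (Suc n))"
    using \<beta>_le_1[of n] \<alpha>_pos[of n] lam_range[of n] by (simp add: H_Suc)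
  have "(2 - \<beta> n) / (2 * \<alpha> n) \<le> 2 / (2 * \<alpha>min)"
    using \<beta>_nonneg[of n] \<beta>_le_1[of n] \<alpha>_range(1)[OF assms] \<alpha>_bounds by (intro frac_le) auto
  then have "(2 - \<beta> n) / (2 * \<alpha> n) * lam n \<le> 1 / \<alpha>min * 1"
    using lam_range[of n] \<alpha>_bounds by (intro mult_mono) auto
  then have "(2 - \<beta> n) / (2 * \<alpha> n) * lam n * (norm (d n))\<^sup>2 \<le> 1 / \<alpha>min * (norm (d n))\<^sup>2"
    by (intro mult_right_mono) auto
  then show "H (Suc n) - E (x (Suc n)) \<le> 1 / \<alpha>min * (norm (d n))\<^sup>2" by (simp add: H_Suc)
qed

lemma E_x_tendsto: "(\<lambda>n. E (x n)) \<longlonglongrightarrow> Elim"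
proof -
  have "(\<lambda>n. H (Suc n) - E (x (Suc n))) \<longlonglongrightarrow> 0"
  proof (rule tendsto_sandwich)
    show "\<forall>\<^sub>F n in sequentially. H (Suc n) - E (x (Suc n)) \<le> 1 / \<alpha>min * (norm (d n))\<^sup>2"
      using eventually_ge_at_top[of 1] by eventually_elim (rule H_Suc_excess)
    show "\<forall>\<^sub>F n in sequentially. 0 \<le> H (Suc n) - E (x (Suc n))"
      using eventually_ge_at_top[of 1] by eventually_elim (rule H_Suc_excess)
    show "(\<lambda>n. 1 / \<alpha>min * (norm (d n))\<^sup>2) \<longlonglongrightarrow> 0"
      by (intro tendsto_mult_right_zero tendsto_null_power norm_d_tendsto_0) simp
  qed simp
  from tendsto_diff[OF LIMSEQ_Suc[OF H_tendsto] this]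
  have "(\<lambda>n. E (x (Suc n))) \<longlonglongrightarrow> Elim" by simp
  then show ?thesis by (rule LIMSEQ_imp_Suc)
qed

text \<open>The upper bound is the descent estimate with \<open>t = 1\<close>, the lower bound the comparison of
  \<open>E (x (Suc n))\<close> with \<open>E (u n)\<close>.\<close>

lemma E_u_tendsto: "(\<lambda>n. E (u n)) \<longlonglongrightarrow> Elim"
proof (rule tendsto_sandwich)
  show "\<forall>\<^sub>F n in sequentially. E (x (Suc n)) - (2 * Lg2 + \<eta>) * (norm (d n))\<^sup>2 \<le> E (u n)"
    using eventually_ge_at_top[of 1] by eventually_elim (use E_x_Suc_le_E_u in \<open>simp add: diff_le_eq\<close>)
  show "\<forall>\<^sub>F n in sequentially. E (u n) \<le> E (x n) + 1 / \<alpha>min * (norm (d n) * len n)"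
    using eventually_ge_at_top[of 1]
  proof eventually_elim
    case (elim n)
    have "E (u n) \<le> E (x n) - 1 / \<alpha> n * (norm (d n))\<^sup>2 + \<beta> n / \<alpha> n * (d n \<bullet> (x n - x (n - 1)))"
      using E_segment_le_extrapolated[OF elim, of 1] by (simp add: d_step)
    moreover have "0 \<le> 1 / \<alpha> n * (norm (d n))\<^sup>2" using \<alpha>_pos[of n] by simp
    ultimately show ?case using extrapolation_inner_le[OF elim] by linarith
  qed
  have "(\<lambda>n. E (x (Suc n)) - (2 * Lg2 + \<eta>) * (norm (d n))\<^sup>2) \<longlonglongrightarrow> Elim - (2 * Lg2 + \<eta>) * 0\<^sup>2"
    by (intro tendsto_intros norm_d_tendsto_0 LIMSEQ_Suc[OF E_x_tendsto])
  then show "(\<lambda>n. E (x (Suc n)) - (2 * Lg2 + \<eta>) * (norm (d n))\<^sup>2) \<longlonglongrightarrow> Elim" by simp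
  have "(\<lambda>n. E (x n) + 1 / \<alpha>min * (norm (d n) * len n)) \<longlonglongrightarrow> Elim + 1 / \<alpha>min * (0 * 0)"
    by (intro tendsto_intros norm_d_tendsto_0 E_x_tendsto len_tendsto_0)
  then show "(\<lambda>n. E (x n) + 1 / \<alpha>min * (norm (d n) * len n)) \<longlonglongrightarrow> Elim" by simp
qed

lemma prox_residual_le:
  assumes "1 \<le> n"
  shows "norm ((1 / \<alpha> n) *\<^sub>R (u n - y n)) \<le> 1 / \<alpha>min * (norm (d n) + len n)"
proof -
  have "norm (u n - y n) \<le> norm (d n) + \<beta> n * len n"
    using norm_triangle_ineq4[of "d n" "\<beta> n *\<^sub>R (x n - x (n - 1))"] \<beta>_nonneg[of n]
    by (simp add: u_minus_y len_def)
  also have "\<dots> \<le> norm (d n) + len n"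
    using mult_right_mono[OF \<beta>_le_1[of n] len_nonneg[of n]] by simp
  finally have "1 / \<alpha> n * norm (u n - y n) \<le> 1 / \<alpha>min * (norm (d n) + len n)"
    using \<alpha>_range(1)[OF assms] \<alpha>_bounds by (intro mult_mono frac_le) auto
  then show ?thesis using \<alpha>_pos[of n] by simp
qed

section \<open>Cluster points\<close>

lemma continuous_gradf: "continuous_on UNIV gradf"
  using f_gradient_lipschitz by (rule lipschitz_on_continuous_on)

lemma continuous_gradg2: "continuous_on UNIV gradg2"
  using g2_gradient_lipschitz by (rule lipschitz_on_continuous_on)

lemma isCont_f: "isCont f p"
  using f_gradient[of p] unfolding gderiv_def by (rule has_derivative_continuous)

lemma isCont_g2: "isCont g2 p"
  using g2_gradient[of p] unfolding gderiv_def by (rule has_derivative_continuous)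

text \<open>Lower semicontinuity, in the form of closed level sets, gives \<open>E p \<le> Elim\<close>, in particular that
  \<open>p\<close> lies in the domain. The subgradient inequalities at \<open>u (r k)\<close> pass to the limit because the
  subgradients \<open>v (r k)\<close> converge. Tested at \<open>p\<close> the limit inequality gives \<open>Elim \<le> E p\<close>, and with
  equality known it says that the limit slope is a subgradient of \<open>g1\<close> at \<open>p\<close>.\<close>

lemma cluster_point_critical:
  assumes r: "filterlim r at_top sequentially" and p: "(\<lambda>k. u (r k)) \<longlonglongrightarrow> p"
  shows "critical_point gradf g1 gradg2 p" and "g1 p \<noteq> \<infinity>" and "E p = Elim"
proof -
  let ?s = "gradg2 p - gradf p"
  have along: "(\<lambda>k. h (r k)) \<longlonglongrightarrow> l" if "h \<longlonglongrightarrow> l" for h :: "nat \<Rightarrow> 'b::topological_space" and l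
    using filterlim_compose[OF that r] .
  have Eu: "(\<lambda>k. E (u (r k))) \<longlonglongrightarrow> Elim" by (rule along[OF E_u_tendsto])
  have level: "energy f g1 g2 p \<le> ereal (Elim + \<epsilon>)" if \<epsilon>: "0 < \<epsilon>" for \<epsilon>
  proof -
    have "\<forall>\<^sub>F k in sequentially. E (u (r k)) < Elim + \<epsilon>"
      using order_tendstoD(2)[OF Eu] \<epsilon> by simp
    then have "\<forall>\<^sub>F k in sequentially. u (r k) \<in> {z. energy f g1 g2 z \<le> ereal (Elim + \<epsilon>)}"
      by eventually_elim (simp add: energy_eq g1_u_finite)
    then have "p \<in> {z. energy f g1 g2 z \<le> ereal (Elim + \<epsilon>)}"
      by (rule Lim_in_closed_set[OF compact_imp_closed[OF energy_level_compact] _ _ p]) simp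
    then show ?thesis by simp
  qed
  show pfin: "g1 p \<noteq> \<infinity>" using level[of 1] energy_infinite[of p] by auto
  have "E p \<le> Elim"
    by (rule field_le_epsilon) (use level energy_eq[OF pfin] in simp)
  have d: "(\<lambda>k. d (r k)) \<longlonglongrightarrow> 0"
    by (rule along[OF tendsto_norm_zero_cancel[OF norm_d_tendsto_0]])
  have "(\<lambda>k. u (r k) - d (r k)) \<longlonglongrightarrow> p - 0" by (intro tendsto_diff p d)
  then have xr: "(\<lambda>k. x (r k)) \<longlonglongrightarrow> p" by (simp add: d_step)
  have "(\<lambda>n. (1 / \<alpha> n) *\<^sub>R (u n - y n)) \<longlonglongrightarrow> 0"
  proof (rule Lim_null_comparison)
    show "\<forall>\<^sub>F n in sequentially. norm ((1 / \<alpha> n) *\<^sub>R (u n - y n)) \<le> 1 / \<alpha>min * (norm (d n) + len n)"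
      using eventually_ge_at_top[of 1] by eventually_elim (rule prox_residual_le)
    show "(\<lambda>n. 1 / \<alpha>min * (norm (d n) + len n)) \<longlonglongrightarrow> 0"
      by (intro tendsto_mult_right_zero tendsto_add_zero norm_d_tendsto_0 len_tendsto_0)
  qed
  then have res: "(\<lambda>k. (1 / \<alpha> (r k)) *\<^sub>R (u (r k) - y (r k))) \<longlonglongrightarrow> 0" by (rule along)
  have "(\<lambda>k. gradg2 (x (r k))) \<longlonglongrightarrow> gradg2 p" "(\<lambda>k. gradf (u (r k))) \<longlonglongrightarrow> gradf p"
    by (auto intro: continuous_on_tendsto_compose[OF continuous_gradg2 xr]
        continuous_on_tendsto_compose[OF continuous_gradf p])
  from tendsto_diff[OF tendsto_diff[OF this(1) res] this(2)]
  have vr: "(\<lambda>k. v (r k)) \<longlonglongrightarrow> ?s" by (simp add: v_def \<xi>_eq)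
  have "(\<lambda>k. E (u (r k)) - f (u (r k)) + g2 (u (r k))) \<longlonglongrightarrow> Elim - f p + g2 p"
    by (intro tendsto_intros Eu isCont_tendsto_compose[OF isCont_f p] isCont_tendsto_compose[OF isCont_g2 p])
  then have g1r: "(\<lambda>k. real_of_ereal (g1 (u (r k)))) \<longlonglongrightarrow> Elim - f p + g2 p"
    by (simp add: E_def)
  have tangent: "Elim - f p + g2 p + ?s \<bullet> (z - p) \<le> real_of_ereal (g1 z)" if "g1 z \<noteq> \<infinity>" for z
  proof (rule tendsto_upperbound)
    show "(\<lambda>k. real_of_ereal (g1 (u (r k))) + v (r k) \<bullet> (z - u (r k)))
        \<longlonglongrightarrow> Elim - f p + g2 p + ?s \<bullet> (z - p)"
      by (intro tendsto_intros g1r vr p)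
  qed (use g1_above_tangent[OF that] in auto)
  from tangent[OF pfin] have "Elim \<le> E p" by (simp add: E_def)
  with \<open>E p \<le> Elim\<close> show "E p = Elim" by simp
  then have "real_of_ereal (g1 p) = Elim - f p + g2 p" by (simp add: E_def)
  then have g1p: "g1 p = ereal (Elim - f p + g2 p)"
    using g1_real[OF pfin] by metis
  have "?s \<in> subdifferential g1 p"
  proof -
    have "g1 p + ereal (?s \<bullet> (z - p)) \<le> g1 z" for z
    proof (cases "g1 z = \<infinity>")
      case False
      have "g1 p + ereal (?s \<bullet> (z - p)) \<le> ereal (real_of_ereal (g1 z))"
        using tangent[OF False] by (simp add: g1p)
      then show ?thesis using g1_real[OF False] by metis
    qed simp
    then show ?thesis using g1p by (simp add: subdifferential_def)
  qed
  then have "gradf p + ?s - gradg2 p \<in> energy_subdifferential gradf g1 gradg2 p"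
    unfolding energy_subdifferential_def by (rule imageI)
  then show "critical_point gradf g1 gradg2 p" by (simp add: critical_point_def)
qed

section \<open>The KL inequality along the run\<close>

lemma dist_zero_energy_subdifferential_le:
  assumes "1 \<le> n"
  shows "dist_zero (energy_subdifferential gradf g1 gradg2 (u n))
    \<le> ereal (Lg2 * norm (d n) + 1 / \<alpha>min * (norm (d n) + len n))"
proof -
  let ?w = "gradf (u n) + v n - gradg2 (u n)"
  have "?w \<in> energy_subdifferential gradf g1 gradg2 (u n)"
    unfolding energy_subdifferential_def using v_subgradient by (rule imageI)
  then have "dist_zero (energy_subdifferential gradf g1 gradg2 (u n)) \<le> ereal (norm ?w)"
    unfolding dist_zero_def by (rule INF_lower)
  moreover have "?w = gradg2 (x n) - gradg2 (u n) - (1 / \<alpha> n) *\<^sub>R (u n - y n)"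
    by (simp add: v_def \<xi>_eq)
  then have "norm ?w \<le> norm (gradg2 (x n) - gradg2 (u n)) + norm ((1 / \<alpha> n) *\<^sub>R (u n - y n))"
    by (simp only: norm_triangle_ineq4)
  then have "norm ?w \<le> Lg2 * norm (d n) + 1 / \<alpha>min * (norm (d n) + len n)"
    using gradg2_lipschitz[of "x n" "u n"] prox_residual_le[OF assms]
    by (simp add: d_step norm_minus_commute)
  ultimately show ?thesis by (meson ereal_less_eq(3) order_trans)
qed

text \<open>The KL inequality bounds the excess of \<open>E (u n)\<close> over \<open>Elim\<close>, and \<open>H (Suc n)\<close> adds a term quadratic
  in \<open>a n = len n + len (Suc n)\<close>. Raising the exponent to at least 1/2 makes the quadratic term
  contribute at most a multiple of \<open>a n\<close>; it weakens the KL inequality, but only for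
  excesses below 1.\<close>

lemma KL_bound_near_cluster_point:
  assumes KL: "KL_exponent (energy f g1 g2) (energy_subdifferential gradf g1 gradg2) \<theta>"
    and r: "filterlim r at_top sequentially" and p: "(\<lambda>k. u (r k)) \<longlonglongrightarrow> p"
  shows "\<exists>C. \<forall>\<^sub>F k in sequentially.
    (H (Suc (r k)) - Elim) powr max \<theta> (1/2) \<le> C * (len (r k) + len (Suc (r k)))"
proof -
  define a where "a n = len n + len (Suc n)" for n
  define \<theta>' where "\<theta>' = max \<theta> (1/2)"
  have \<theta>: "0 \<le> \<theta>" "\<theta> < 1" using KL by (auto simp: KL_exponent_def)
  have \<theta>': "\<theta> \<le> \<theta>'" "1/2 \<le> \<theta>'" "\<theta>' < 1" using \<theta> by (auto simp: \<theta>'_def)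
  have a: "0 \<le> a n" "len n \<le> a n" for n by (auto simp: a_def len_nonneg)
  note crit = cluster_point_critical[OF r p]
  have Ep: "energy f g1 g2 p = ereal Elim" using energy_eq[OF crit(2)] crit(3) by simp
  obtain c \<epsilon> \<nu> where c: "0 < c" and \<epsilon>: "0 < \<epsilon>" and \<nu>: "0 < (\<nu>::ereal)"
    and KLp: "\<And>z. norm (z - p) \<le> \<epsilon> \<Longrightarrow> ereal Elim < energy f g1 g2 z \<Longrightarrow>
        energy f g1 g2 z < ereal Elim + \<nu> \<Longrightarrow>
        ereal (c * real_of_ereal (energy f g1 g2 z - ereal Elim) powr \<theta>)
          \<le> dist_zero (energy_subdifferential gradf g1 gradg2 z)"
    using KL crit(1) unfolding KL_exponent_def critical_point_def Ep[symmetric] by metis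
  obtain D where D: "0 \<le> D" "\<And>n. 1 \<le> n \<Longrightarrow> norm (d n) \<le> D * a n"
    using norm_d_le unfolding a_def by blast
  define K1 where "K1 = Lg2 * D + 1 / \<alpha>min * (D + 1)"
  define K2 where "K2 = (2 * Lg2 + \<eta> + 1 / \<alpha>min) * D\<^sup>2"
  have K2: "0 \<le> K2" using Lg2_nonneg \<eta>_range \<alpha>_bounds by (simp add: K2_def)
  have dist: "dist_zero (energy_subdifferential gradf g1 gradg2 (u n)) \<le> ereal (K1 * a n)"
    if n: "1 \<le> n" for n
  proof -
    have "Lg2 * norm (d n) + 1 / \<alpha>min * (norm (d n) + len n)
        \<le> Lg2 * (D * a n) + 1 / \<alpha>min * (D * a n + a n)"
      using D(2)[OF n] a[of n] Lg2_nonneg \<alpha>_bounds by (intro add_mono mult_left_mono) auto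
    also have "\<dots> = K1 * a n" by (simp add: K1_def algebra_simps add_divide_distrib)
    finally show ?thesis
      using dist_zero_energy_subdifferential_le[OF n] by (meson ereal_less_eq(3) order_trans)
  qed
  have H_le: "H (Suc n) \<le> E (u n) + K2 * (a n)\<^sup>2" if n: "1 \<le> n" for n
  proof -
    have "H (Suc n) \<le> E (u n) + ((2 * Lg2 + \<eta>) * (norm (d n))\<^sup>2 + 1 / \<alpha>min * (norm (d n))\<^sup>2)"
      using H_Suc_excess(2)[OF n] E_x_Suc_le_E_u[OF n] by linarith
    also have "\<dots> = E (u n) + (2 * Lg2 + \<eta> + 1 / \<alpha>min) * (norm (d n))\<^sup>2"
      by (simp only: distrib_right)
    also have "\<dots> \<le> E (u n) + (2 * Lg2 + \<eta> + 1 / \<alpha>min) * (D * a n)\<^sup>2"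
      using D(2)[OF n] Lg2_nonneg \<eta>_range \<alpha>_bounds
      by (intro add_left_mono mult_left_mono power_mono) auto
    finally show ?thesis by (simp only: K2_def power_mult_distrib mult.assoc)
  qed
  have Eu: "(\<lambda>k. E (u (r k))) \<longlonglongrightarrow> Elim" using filterlim_compose[OF E_u_tendsto r] .
  have "a \<longlonglongrightarrow> 0 + 0"
    unfolding a_def by (intro tendsto_add len_tendsto_0 LIMSEQ_Suc[OF len_tendsto_0])
  then have ar: "(\<lambda>k. a (r k)) \<longlonglongrightarrow> 0" using filterlim_compose[OF _ r] by simp
  have "(\<lambda>k. norm (u (r k) - p)) \<longlonglongrightarrow> 0" using p by (simp add: LIM_zero tendsto_norm_zero)
  then have "\<forall>\<^sub>F k in sequentially. norm (u (r k) - p) < \<epsilon>" using order_tendstoD(2) \<epsilon> by blast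
  moreover have "\<forall>\<^sub>F k in sequentially. E (u (r k)) < Elim + 1"
    by (rule order_tendstoD(2)[OF Eu]) simp
  moreover have "\<forall>\<^sub>F k in sequentially. ereal (E (u (r k))) < ereal Elim + \<nu>"
    by (rule order_tendstoD(2)[OF tendsto_ereal[OF Eu]]) (use \<nu> in \<open>cases \<nu>; simp\<close>)
  moreover have "\<forall>\<^sub>F k in sequentially. a (r k) < 1"
    by (rule order_tendstoD(2)[OF ar]) simp
  moreover have "\<forall>\<^sub>F k in sequentially. 1 \<le> r k"
    using r by (simp add: filterlim_at_top)
  ultimately have "\<forall>\<^sub>F k in sequentially.
    (H (Suc (r k)) - Elim) powr \<theta>' \<le> 2 * (K1 / c + K2 powr \<theta>') * a (r k)"
  proof eventually_elim
    case (elim k)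
    let ?n = "r k"
    define e where "e = max 0 (E (u ?n) - Elim)"
    have e_powr: "e powr \<theta>' \<le> K1 / c * a ?n"
    proof (cases "E (u ?n) \<le> Elim")
      case True
      have "0 \<le> K1" using D(1) Lg2_nonneg \<alpha>_bounds by (simp add: K1_def)
      then show ?thesis using True c a[of ?n] by (simp add: e_def)
    next
      case False
      then have e: "e = E (u ?n) - Elim" by (simp add: e_def)
      have "e powr \<theta>' \<le> e powr \<theta>"
        using False elim \<theta>' by (intro powr_mono') (auto simp: e)
      moreover have "ereal (c * e powr \<theta>) \<le> ereal (K1 * a ?n)"
        by (rule order_trans[OF _ dist])
          (use KLp[of "u ?n"] elim False in \<open>simp_all add: energy_eq g1_u_finite e\<close>)
      ultimately have "c * e powr \<theta>' \<le> K1 * a ?n"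
        using c by (smt (verit) ereal_less_eq(3) mult_left_mono)
      then show ?thesis using c by (simp add: field_simps)
    qed
    have "((a ?n)\<^sup>2) powr \<theta>' \<le> ((a ?n)\<^sup>2) powr (1/2)"
      using elim a[of ?n] \<theta>' by (intro powr_mono') (auto simp: power_le_one)
    also have "\<dots> = a ?n" using a[of ?n] by (simp add: powr_half_sqrt)
    finally have "(K2 * (a ?n)\<^sup>2) powr \<theta>' \<le> K2 powr \<theta>' * a ?n"
      by (simp add: powr_mult mult_left_mono)
    moreover have "(H (Suc ?n) - Elim) powr \<theta>' \<le> 2 * (e powr \<theta>' + (K2 * (a ?n)\<^sup>2) powr \<theta>')"
    proof (rule powr_add_le)
      show "H (Suc ?n) - Elim \<le> e + K2 * (a ?n)\<^sup>2" using H_le[of ?n] elim by (simp add: e_def)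
      show "0 \<le> H (Suc ?n) - Elim" using Elim_le_H[of "Suc ?n"] elim by simp
    qed (use K2 \<theta>' in \<open>auto simp: e_def\<close>)
    ultimately show ?case using e_powr by (simp only: distrib_right distrib_left mult.assoc)
  qed
  then show ?thesis unfolding \<theta>'_def a_def by blast
qed

text \<open>Were no constant valid for all large \<open>n\<close>, there would be indices violating the bound with
  constants tending to infinity. A subsequence of the iterates at these indices converges, and the
  bound near its limit is violated.\<close>

lemma KL_bound_along_run:
  assumes KL: "KL_exponent (energy f g1 g2) (energy_subdifferential gradf g1 gradg2) \<theta>"
  shows "\<exists>C N. \<forall>n\<ge>N. (H (Suc n) - Elim) powr max \<theta> (1/2) \<le> C * (len n + len (Suc n))"
proof (rule ccontr)
  assume "\<not> ?thesis"
  then have "\<forall>k::nat. \<exists>n\<ge>k.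
      real k * (len n + len (Suc n)) < (H (Suc n) - Elim) powr max \<theta> (1/2)"
    by (meson not_less)
  then obtain r where r: "\<And>k. k \<le> r k"
    and viol: "\<And>k. real k * (len (r k) + len (Suc (r k)))
        < (H (Suc (r k)) - Elim) powr max \<theta> (1/2)"
    by metis
  have "bounded (range (\<lambda>k. x (r k)))"
    using bounded_run by (rule bounded_subset) auto
  then obtain p s where s: "strict_mono (s :: nat \<Rightarrow> nat)" and xp: "((\<lambda>k. x (r k)) \<circ> s) \<longlonglongrightarrow> p"
    using bounded_imp_convergent_subsequence by blast
  have "filterlim r at_top sequentially"
    by (rule filterlim_at_top_mono[OF filterlim_ident]) (simp add: r)
  then have rs: "filterlim (\<lambda>k. r (s k)) at_top sequentially"
    using filterlim_compose filterlim_subseq[OF s] by blast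
  have "(\<lambda>k. x (r (s k)) + d (r (s k))) \<longlonglongrightarrow> p + 0"
    using xp filterlim_compose[OF tendsto_norm_zero_cancel[OF norm_d_tendsto_0] rs]
    by (intro tendsto_add) (auto simp: o_def)
  then have "(\<lambda>k. u (r (s k))) \<longlonglongrightarrow> p" by (simp add: d_step)
  from KL_bound_near_cluster_point[OF KL rs this] obtain C where
    "\<forall>\<^sub>F k in sequentially. (H (Suc (r (s k))) - Elim) powr max \<theta> (1/2)
      \<le> C * (len (r (s k)) + len (Suc (r (s k))))"
    by blast
  moreover have "\<forall>\<^sub>F k in sequentially. C \<le> real (s k)"
    using filterlim_compose[OF filterlim_real_sequentially filterlim_subseq[OF s]]
    by (simp add: filterlim_at_top)
  ultimately have "\<forall>\<^sub>F k in sequentially. False"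
  proof eventually_elim
    case (elim k)
    have "C * (len (r (s k)) + len (Suc (r (s k)))) \<le> real (s k) * (len (r (s k)) + len (Suc (r (s k))))"
      using elim by (intro mult_right_mono) (auto simp: len_nonneg)
    then show ?case using elim viol[of "s k"] by linarith
  qed
  then show False by simp
qed

lemma summable_len:
  assumes KL: "KL_exponent (energy f g1 g2) (energy_subdifferential gradf g1 gradg2) \<theta>"
  shows "summable len"
proof -
  obtain C N where CN: "\<And>n. N \<le> n \<Longrightarrow>
      (H (Suc n) - Elim) powr max \<theta> (1/2) \<le> C * (len n + len (Suc n))"
    using KL_bound_along_run[OF KL] by blast
  define M where "M = max N 2"
  have "summable (\<lambda>n. len (n + M))"
  proof (rule summable_steps_if_powr_descent)
    show "0 < min c0 (1 / (2 * \<alpha>max))" by (rule descent_rate_pos)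
    show "max \<theta> (1/2) < 1" using KL by (simp add: KL_exponent_def)
    fix n
    show "0 \<le> len (n + M)" by (rule len_nonneg)
    show "0 \<le> H (n + M) - Elim" using Elim_le_H[of "n + M"] by (simp add: M_def)
    show "min c0 (1 / (2 * \<alpha>max)) * (len (n + M))\<^sup>2 \<le> (H (n + M) - Elim) - (H (Suc n + M) - Elim)"
      using H_descent[of "n + M"] by (simp add: M_def)
    show "(H (Suc n + M) - Elim) powr max \<theta> (1/2) \<le> C * (len (n + M) + len (Suc n + M))"
      using CN[of "n + M"] by (simp add: M_def)
  qed simp
  then show ?thesis by (simp only: summable_iff_shift)
qed

lemma run_converges:
  assumes KL: "KL_exponent (energy f g1 g2) (energy_subdifferential gradf g1 gradg2) \<theta>"
  shows "\<exists>xstar. critical_point gradf g1 gradg2 xstar \<and> x \<longlonglongrightarrow> xstar \<and>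
           summable (\<lambda>n. norm (x (Suc n) - x n))"
proof -
  have "summable (\<lambda>n. len (Suc n))" using summable_len[OF KL] by (simp only: summable_Suc_iff)
  then have sum: "summable (\<lambda>n. norm (x (Suc n) - x n))" by (simp add: len_def)
  then have "summable (\<lambda>n. x (Suc n) - x n)" by (rule summable_norm_cancel)
  from summable_LIMSEQ[OF this] obtain l where "(\<lambda>n. x n - x 0) \<longlonglongrightarrow> l"
    by (auto simp: sum_lessThan_telescope)
  from tendsto_add[OF this tendsto_const[of "x 0"]] have xl: "x \<longlonglongrightarrow> l + x 0" by simp
  have "(\<lambda>n. x n + d n) \<longlonglongrightarrow> l + x 0 + 0"
    by (rule tendsto_add[OF xl tendsto_norm_zero_cancel[OF norm_d_tendsto_0]])
  then have "(\<lambda>n. u n) \<longlonglongrightarrow> l + x 0" by (simp add: d_step)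
  from cluster_point_critical(1)[OF filterlim_ident this] xl sum show ?thesis by blast
qed

end

theorem theorem7:
  fixes f g2 :: "'a::euclidean_space \<Rightarrow> real"
    and gradf gradg2 :: "'a \<Rightarrow> 'a"
    and g1 :: "'a \<Rightarrow> ereal"
    and L Lg2 \<theta> :: real
    and \<alpha>min \<alpha>max \<rho> \<beta>bar \<omega> \<eta> c0 :: real
    and x y \<xi> u d :: "nat \<Rightarrow> 'a"
    and \<alpha> \<beta> lam :: "nat \<Rightarrow> real"
  assumes problem: "dc_problem f gradf L g1 g2"
    and g2_gradient: "\<And>z. GDERIV g2 z :> gradg2 z"
    and g2_gradient_lipschitz: "Lg2-lipschitz_on UNIV gradg2"
    and run: "pABBDCA_se f gradf g1 g2 \<alpha>min \<alpha>max \<rho> \<beta>bar \<omega> \<eta> c0 x y \<xi> u d \<alpha> \<beta> lam"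
    and bounded_run: "bounded (range x)"
    and KL: "KL_exponent (energy f g1 g2) (energy_subdifferential gradf g1 gradg2) \<theta>"
  shows "\<exists>xstar. critical_point gradf g1 gradg2 xstar \<and> x \<longlonglongrightarrow> xstar \<and>
           summable (\<lambda>n. norm (x (Suc n) - x n))"
proof -
  interpret smooth_pABBDCA_se f gradf L g1 g2 \<alpha>min \<alpha>max \<rho> \<beta>bar \<omega> \<eta> c0 x y \<xi> u d \<alpha> \<beta> lam gradg2 Lg2
    using problem run g2_gradient g2_gradient_lipschitz bounded_run
    by (intro smooth_pABBDCA_se.intro smooth_pABBDCA_se_axioms.intro)
  show ?thesis using KL by (rule run_converges)
qed

end
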